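(* Work in Incomprehensive Set Theory (defined in the context). Then: (1) No lower link intersects any upper link: there are no objects $x,y,u,v$ such that $(x,y)$ is a lower ascending or lower descending link, $(u,v)$ is an upper ascending or upper descending link, and $\{x,y\}\cap\{u,v\}\neq\emptyset$ (equivalently, no set is both a lower and an upper). (2) For any lower $x$, the pair $x$ and $x^{++}$ constitutes a lower ascending link, i.e. $x\in x^{++}$, $x\neq x^{++}$, and both $x$ and $x^{++}$ are lowers. (3) For any upper $x$, the pair $x$ and $x^{--}$ constitutes an upper descending link, i.e. $x^{--}\in x$, $x\neq x^{--}$, and both $x$ and $x^{--}$ are uppers.
   Context: Incomprehensive Set Theory is the first-order theory in the language $\{\in,=\}$ whose only axioms are: Existence of Successor, $\forall x\,\exists! y\,\forall z\,(z\in y \iff z\in x \lor z=x)$; and Existence of Predecessor, $\forall x\,\exists! y\,\forall z\,(z\in y\iff z\in x\wedge z\neq x)$. No extensionality axiom is assumed. The unique $y$ in the first axiom is written $x^{++}$ (so $x^{++}$ is "$x\cup\{x\}$"), the unique $y$ in the second is written $x^{--}$ (so $x^{--}$ is "$x\setminus\{x\}$"). An object $x$ is a lower (Lower Russellian Set) if $\forall z\in x,\ z\notin z$; an upper (Upper Russellian Set) if $\forall z\,(z\notin z\Rightarrow z\in x)$. For a predicate $\phi$: $(x,y)$ is a $\phi$ ascending link if $x\in y$, $x\neq y$, $\phi(x)$ and $\phi(y)$; a $\phi$ descending link if $y\in x$, $x\neq y$, $\phi(x)$ and $\phi(y)$. A lower (resp. upper) link is a $\phi$ link with $\phi$ = "is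 a lower" (resp. "is an upper"). *)

theory Defs
  imports Main
begin

text \<open>
  A model of Incomprehensive Set Theory: the universe of objects is the (arbitrary, nonempty)
  type \<open>'a\<close>, and \<open>mem z x\<close> interprets \<open>z \<in> x\<close>. Equality is genuine equality of
  objects, and no extensionality is assumed.
\<close>

locale incomprehensive_set_theory =
  fixes mem :: "'a \<Rightarrow> 'a \<Rightarrow> bool"
  assumes existence_of_successor: "\<forall>x. \<exists>!y. \<forall>z. mem z y \<longleftrightarrow> mem z x \<or> z = x"
    and existence_of_predecessor: "\<forall>x. \<exists>!y. \<forall>z. mem z y \<longleftrightarrow> mem z x \<and> z \<noteq> x"

text \<open>
  The notions below take \<open>mem\<close> as an explicit argument. The definite descriptions \<open>x\<^sup>+\<^sup>+\<close> and
  \<open>x\<^sup>-\<^sup>-\<close> are meaningful only when \<open>mem\<close> satisfies the axioms above.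
\<close>

definition successor :: "('a \<Rightarrow> 'a \<Rightarrow> bool) \<Rightarrow> 'a \<Rightarrow> 'a" where
  "successor mem x = (THE y. \<forall>z. mem z y \<longleftrightarrow> mem z x \<or> z = x)"

definition predecessor :: "('a \<Rightarrow> 'a \<Rightarrow> bool) \<Rightarrow> 'a \<Rightarrow> 'a" where
  "predecessor mem x = (THE y. \<forall>z. mem z y \<longleftrightarrow> mem z x \<and> z \<noteq> x)"

definition lower :: "('a \<Rightarrow> 'a \<Rightarrow> bool) \<Rightarrow> 'a \<Rightarrow> bool" where
  "lower mem x \<longleftrightarrow> (\<forall>z. mem z x \<longrightarrow> \<not> mem z z)"

definition upper :: "('a \<Rightarrow> 'a \<Rightarrow> bool) \<Rightarrow> 'a \<Rightarrow> bool" where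
  "upper mem x \<longleftrightarrow> (\<forall>z. \<not> mem z z \<longrightarrow> mem z x)"

definition ascending_link ::
    "('a \<Rightarrow> 'a \<Rightarrow> bool) \<Rightarrow> ('a \<Rightarrow> bool) \<Rightarrow> 'a \<Rightarrow> 'a \<Rightarrow> bool" where
  "ascending_link mem \<phi> x y \<longleftrightarrow> mem x y \<and> x \<noteq> y \<and> \<phi> x \<and> \<phi> y"

definition descending_link ::
    "('a \<Rightarrow> 'a \<Rightarrow> bool) \<Rightarrow> ('a \<Rightarrow> bool) \<Rightarrow> 'a \<Rightarrow> 'a \<Rightarrow> bool" where
  "descending_link mem \<phi> x y \<longleftrightarrow> mem y x \<and> x \<noteq> y \<and> \<phi> x \<and> \<phi> y"

end

theory Submission
  imports Defs
begin

(* Russell's argument in three guises: a lower is never a member of itself, an upper always is,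
   so nothing is both. Hence adding x to a lower x, or removing x from an upper x, really changes x
   and leaves the respective class closed. *)

text \<open>Instantiating the bounded quantifier of \<open>lower\<close> at \<open>x\<close> itself
  makes \<open>mem x x\<close> imply its own negation; for \<open>upper\<close> the same instance
  makes the negation imply \<open>mem x x\<close>.\<close>

lemma lower_not_self_mem: "lower mem x \<Longrightarrow> \<not> mem x x"
  by (auto simp: lower_def)

lemma upper_self_mem: "upper mem x \<Longrightarrow> mem x x"
  by (auto simp: upper_def)

context incomprehensive_set_theory
begin

text \<open>Unique existence is what gives the description in \<open>successor\<close> a value; from
  here on that value is handled only through its members.\<close>

lemma mem_successor_iff: "mem z (successor mem x) \<longleftrightarrow> mem z x \<or> z = x"
  using theI'[OF existence_of_successor[rule_format, of x]]
  unfolding successor_def by blast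

lemma mem_predecessor_iff: "mem z (predecessor mem x) \<longleftrightarrow> mem z x \<and> z \<noteq> x"
  using theI'[OF existence_of_predecessor[rule_format, of x]]
  unfolding predecessor_def by blast

lemma ascending_link_successor:
  assumes "lower mem x"
  shows "ascending_link mem (lower mem) x (successor mem x)"
proof -
  \<comment> \<open>The only member that may be new is \<open>x\<close>, and it is not a member of
    itself.\<close>
  have "lower mem (successor mem x)"
    using assms lower_not_self_mem[OF assms] by (auto simp: lower_def mem_successor_iff)
  \<comment> \<open>The two are told apart by \<open>x\<close>, a member of the successor but not of
    \<open>x\<close>.\<close>
  moreover have "x \<noteq> successor mem x"
    using lower_not_self_mem[OF assms] mem_successor_iff[of x x] by auto
  ultimately show ?thesis
    using assms by (simp add: ascending_link_def mem_successor_iff)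
qed

lemma descending_link_predecessor:
  assumes "upper mem x"
  shows "descending_link mem (upper mem) x (predecessor mem x)"
proof -
  \<comment> \<open>Only \<open>x\<close> is removed, and being a member of itself it is not among
    the objects that an upper must contain.\<close>
  have up: "upper mem (predecessor mem x)"
    using assms upper_self_mem[OF assms] by (auto simp: upper_def mem_predecessor_iff)
  \<comment> \<open>By \<open>up\<close> the predecessor is a member of itself; the membership rule,
    read with the predecessor as the element, then gives both facts at once.\<close>
  moreover have "mem (predecessor mem x) x" "x \<noteq> predecessor mem x"
    using upper_self_mem[OF up] mem_predecessor_iff[of "predecessor mem x" x] by auto
  ultimately show ?thesis
    using assms by (simp add: descending_link_def)
qed

end

theorem theorem4p6:
  fixes mem :: "'a \<Rightarrow> 'a \<Rightarrow> bool"
  assumes "incomprehensive_set_theory mem"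
  shows
    "(\<not> (\<exists>x y u v.
          (ascending_link mem (lower mem) x y \<or> descending_link mem (lower mem) x y) \<and>
          (ascending_link mem (upper mem) u v \<or> descending_link mem (upper mem) u v) \<and>
          {x, y} \<inter> {u, v} \<noteq> {})
      \<and> \<not> (\<exists>x. lower mem x \<and> upper mem x))
    \<and> (\<forall>x. lower mem x \<longrightarrow> ascending_link mem (lower mem) x (successor mem x))
    \<and> (\<forall>x. upper mem x \<longrightarrow> descending_link mem (upper mem) x (predecessor mem x))"
proof -
  interpret incomprehensive_set_theory mem
    by (fact assms)
  have disjoint: "\<not> (lower mem x \<and> upper mem x)" for x
    using lower_not_self_mem[of mem x] upper_self_mem[of mem x] by blast
  \<comment> \<open>Only the types of the endpoints matter: an endpoint shared by a lower and an
    upper link would contradict \<open>disjoint\<close>.\<close>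
  have "lower mem x \<and> lower mem y"
    if "ascending_link mem (lower mem) x y \<or> descending_link mem (lower mem) x y" for x y
    using that by (auto simp: ascending_link_def descending_link_def)
  moreover have "upper mem u \<and> upper mem v"
    if "ascending_link mem (upper mem) u v \<or> descending_link mem (upper mem) u v" for u v
    using that by (auto simp: ascending_link_def descending_link_def)
  ultimately show ?thesis
    using disjoint ascending_link_successor descending_link_predecessor by blast
qed

end
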